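(* Let $(Q,\cdot,\backslash)$ be a left division left cancelation groupoid which satisfies the cyclic associative law $x\cdot(y\cdot z)=(z\cdot x)\cdot y$ for all $x,y,z\in Q$. Then $(Q,\cdot)$ is a commutative group, and it satisfies each of the following identities for all $x,y,z\in Q$: $x\cdot(y\cdot z)=(x\cdot y)\cdot z$; $x\cdot(y\cdot z)=z\cdot(y\cdot x)$; $x\cdot(y\cdot z)=y\cdot(x\cdot z)$; $x\cdot(y\cdot z)=(z\cdot x)\cdot y$.
   Context: A groupoid $(Q,\cdot)$ is a non-empty set $Q$ with a binary operation $\cdot$. For $a\in Q$ let $L_a:Q\to Q$, $L_a x=a\cdot x$. The groupoid is a left division groupoid if $L_a$ is surjective for every $a\in Q$, and a left cancelation groupoid if $L_a$ is injective for every $a\in Q$. Writing a left division left cancelation groupoid as $(Q,\cdot,\backslash)$ means that $\backslash$ is the binary operation on $Q$ satisfying $x\cdot(x\backslash y)=y$ and $x\backslash(x\cdot y)=y$ for all $x,y\in Q$. *)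

theory Defs
  imports "HOL-Algebra.Group"
begin

text \<open>Operations are total functions on the ambient type; only their values on the carrier
  \<open>Q\<close> matter, and they are required to map \<open>Q \<times> Q\<close> into \<open>Q\<close>.\<close>

definition groupoid :: "'a set \<Rightarrow> ('a \<Rightarrow> 'a \<Rightarrow> 'a) \<Rightarrow> bool" where
  "groupoid Q m \<longleftrightarrow> Q \<noteq> {} \<and> (\<forall>x\<in>Q. \<forall>y\<in>Q. m x y \<in> Q)"

definition left_translation :: "('a \<Rightarrow> 'a \<Rightarrow> 'a) \<Rightarrow> 'a \<Rightarrow> 'a \<Rightarrow> 'a" where
  "left_translation m a = (\<lambda>x. m a x)"

definition left_division_groupoid :: "'a set \<Rightarrow> ('a \<Rightarrow> 'a \<Rightarrow> 'a) \<Rightarrow> bool" where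
  "left_division_groupoid Q m \<longleftrightarrow>
     groupoid Q m \<and> (\<forall>a\<in>Q. left_translation m a ` Q = Q)"

definition left_cancelation_groupoid :: "'a set \<Rightarrow> ('a \<Rightarrow> 'a \<Rightarrow> 'a) \<Rightarrow> bool" where
  "left_cancelation_groupoid Q m \<longleftrightarrow>
     groupoid Q m \<and> (\<forall>a\<in>Q. inj_on (left_translation m a) Q)"

definition left_div_left_canc_groupoid ::
    "'a set \<Rightarrow> ('a \<Rightarrow> 'a \<Rightarrow> 'a) \<Rightarrow> ('a \<Rightarrow> 'a \<Rightarrow> 'a) \<Rightarrow> bool" where
  "left_div_left_canc_groupoid Q m d \<longleftrightarrow>
     left_division_groupoid Q m \<and> left_cancelation_groupoid Q m \<and>
     (\<forall>x\<in>Q. \<forall>y\<in>Q. d x y \<in> Q) \<and>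
     (\<forall>x\<in>Q. \<forall>y\<in>Q. m x (d x y) = y \<and> d x (m x y) = y)"

text \<open>A bare pair \<open>(Q, m)\<close> carries no distinguished unit, whereas the library's group
  record does; hence the existential quantifier.\<close>

definition is_comm_group :: "'a set \<Rightarrow> ('a \<Rightarrow> 'a \<Rightarrow> 'a) \<Rightarrow> bool" where
  "is_comm_group Q m \<longleftrightarrow> (\<exists>e. comm_group \<lparr>carrier = Q, mult = m, one = e\<rparr>)"

end

theory Submission
  imports Defs
begin

text \<open>The law rewrites \<open>(x \<cdot> a) \<cdot> z\<close> as \<open>a \<cdot> (z \<cdot> x)\<close>, so left cancelation gives right cancelation.
  If \<open>a \<cdot> e = a\<close>, then \<open>x \<cdot> a = x \<cdot> (a \<cdot> e) = (e \<cdot> x) \<cdot> a\<close>, so \<open>e\<close> is a left unit; and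
  \<open>y \<cdot> a = e \<cdot> (y \<cdot> a) = (a \<cdot> e) \<cdot> y = a \<cdot> y\<close>. Since \<open>a\<close> is arbitrary, the operation is
  commutative, and associativity is then the cyclic law.\<close>

theorem theorem4:
  fixes Q :: "'a set" and m :: "'a \<Rightarrow> 'a \<Rightarrow> 'a" (infixl "\<cdot>" 70)
    and d :: "'a \<Rightarrow> 'a \<Rightarrow> 'a"
  assumes "left_div_left_canc_groupoid Q m d"
    and "\<forall>x\<in>Q. \<forall>y\<in>Q. \<forall>z\<in>Q. x \<cdot> (y \<cdot> z) = (z \<cdot> x) \<cdot> y"
  shows "is_comm_group Q m
    \<and> (\<forall>x\<in>Q. \<forall>y\<in>Q. \<forall>z\<in>Q. x \<cdot> (y \<cdot> z) = (x \<cdot> y) \<cdot> z)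
    \<and> (\<forall>x\<in>Q. \<forall>y\<in>Q. \<forall>z\<in>Q. x \<cdot> (y \<cdot> z) = z \<cdot> (y \<cdot> x))
    \<and> (\<forall>x\<in>Q. \<forall>y\<in>Q. \<forall>z\<in>Q. x \<cdot> (y \<cdot> z) = y \<cdot> (x \<cdot> z))
    \<and> (\<forall>x\<in>Q. \<forall>y\<in>Q. \<forall>z\<in>Q. x \<cdot> (y \<cdot> z) = (z \<cdot> x) \<cdot> y)"
proof -
  have ne: "Q \<noteq> {}"
    and closed: "\<And>x y. x \<in> Q \<Longrightarrow> y \<in> Q \<Longrightarrow> x \<cdot> y \<in> Q"
    and d_closed: "\<And>x y. x \<in> Q \<Longrightarrow> y \<in> Q \<Longrightarrow> d x y \<in> Q"
    and m_d: "\<And>x y. x \<in> Q \<Longrightarrow> y \<in> Q \<Longrightarrow> x \<cdot> d x y = y"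
    and d_m: "\<And>x y. x \<in> Q \<Longrightarrow> y \<in> Q \<Longrightarrow> d x (x \<cdot> y) = y"
    using assms(1)
    by (auto simp: left_div_left_canc_groupoid_def left_division_groupoid_def groupoid_def)
  have cyc: "x \<cdot> (y \<cdot> z) = (z \<cdot> x) \<cdot> y" if "x \<in> Q" "y \<in> Q" "z \<in> Q" for x y z
    using assms(2) that by blast
  have left_cancel: "y = z" if "x \<cdot> y = x \<cdot> z" "x \<in> Q" "y \<in> Q" "z \<in> Q" for x y z
    using d_m that by metis
  have right_cancel: "x = y" if "x \<cdot> a = y \<cdot> a" "x \<in> Q" "y \<in> Q" "a \<in> Q" for x y a
  proof -
    \<comment> \<open>The cyclic law turns the sides into \<open>(x \<cdot> a) \<cdot> a\<close> and
      \<open>(y \<cdot> a) \<cdot> a\<close>; the factor \<open>a\<close> then cancels twice on the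
      left.\<close>
    have "a \<cdot> (a \<cdot> x) = a \<cdot> (a \<cdot> y)"
      using that by (simp add: cyc)
    then show ?thesis
      using left_cancel closed that by blast
  qed
  \<comment> \<open>\<open>d a a\<close> is the solution \<open>e\<close> of
    \<open>a \<cdot> e = a\<close>.\<close>
  have left_unit: "d a a \<cdot> x = x" if "a \<in> Q" "x \<in> Q" for a x
  proof (rule right_cancel)
    show "(d a a \<cdot> x) \<cdot> a = x \<cdot> a"
      using cyc[of x a "d a a"] m_d d_closed that by simp
  qed (use that closed d_closed in auto)
  have comm: "x \<cdot> y = y \<cdot> x" if "x \<in> Q" "y \<in> Q" for x y
    \<comment> \<open>The unit is built from \<open>y\<close> itself, so that
      \<open>y \<cdot> d y y = y\<close> reduces the right side of the law to
      \<open>y \<cdot> x\<close>.\<close>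
    using cyc[of "d y y" x y] left_unit m_d d_closed closed that by simp
  have assoc: "x \<cdot> (y \<cdot> z) = (x \<cdot> y) \<cdot> z" if "x \<in> Q" "y \<in> Q" "z \<in> Q" for x y z
    using cyc[of z x y] comm closed that by metis
  have left_comm: "x \<cdot> (y \<cdot> z) = y \<cdot> (x \<cdot> z)" if "x \<in> Q" "y \<in> Q" "z \<in> Q" for x y z
    using assoc comm that by metis
  have reverse: "x \<cdot> (y \<cdot> z) = z \<cdot> (y \<cdot> x)" if "x \<in> Q" "y \<in> Q" "z \<in> Q" for x y z
    using left_comm comm that by metis
  obtain a where a: "a \<in> Q"
    using ne by blast
  have "comm_group \<lparr>carrier = Q, mult = m, one = d a a\<rparr>"
  proof (rule comm_groupI)
    fix x assume "x \<in> carrier \<lparr>carrier = Q, mult = m, one = d a a\<rparr>"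
    \<comment> \<open>Division gives a right inverse of \<open>x\<close>; commutativity makes it the
      left inverse that \<open>comm_groupI\<close> asks for.\<close>
    then have "d x (d a a) \<in> Q" "d x (d a a) \<cdot> x = d a a"
      using a d_closed m_d comm by auto
    then show "\<exists>y\<in>carrier \<lparr>carrier = Q, mult = m, one = d a a\<rparr>.
        y \<otimes>\<^bsub>\<lparr>carrier = Q, mult = m, one = d a a\<rparr>\<^esub> x = \<one>\<^bsub>\<lparr>carrier = Q, mult = m, one = d a a\<rparr>\<^esub>"
      by auto
  qed (use a closed d_closed left_unit in \<open>auto simp: assoc intro: comm\<close>)
  then have "is_comm_group Q m"
    unfolding is_comm_group_def by blast
  then show ?thesis
    using assoc reverse left_comm assms(2) by blast
qed

end
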